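(* Let $\alpha$ denote the arrow pattern $(12;1\to 3)$, and for $n\ge 1$ let $a_n(123,\alpha)$ be the number of permutations in $\mathfrak{S}_n$ that avoid both the classical pattern $123$ and the arrow pattern $\alpha$. Then for every integer $n\ge 2$, $$a_n(123,\alpha)=2^n-n.$$
   Context: $\mathfrak{S}_n$ is the set of permutations of $[n]=\{1,\dots,n\}$, written in one-line notation $\sigma=\sigma_1\cdots\sigma_n$ with $\sigma_i=\sigma(i)$. A permutation $\sigma\in\mathfrak{S}_n$ contains the classical pattern $\pi\in\mathfrak{S}_m$ if there are $1\le i_1<\cdots<i_m\le n$ such that $\sigma_{i_1}\cdots\sigma_{i_m}$ is order-isomorphic to $\pi$; otherwise it avoids $\pi$. Standard cycle notation: every cycle (including fixed points) is written as $(a\ \sigma(a)\ \sigma^2(a)\cdots)$ beginning with its maximal element $a$, and the cycles are listed from left to right in increasing order of their maximal elements. The bijection $\Phi:\mathfrak{S}_n\to\mathfrak{S}_n$ sends $\sigma$ to the permutation whose one-line notation is obtained by erasing the parentheses in the standard cycle notation of $\sigma$. For $\sigma\in\mathfrak{S}_n$ write $\hat\sigma=\Phi^{-1}(\sigma)$. An arrow pattern of size $k$ is a pair $(\nu;H)$ with $\nu=a_1\ldots a_m$ a string of positive integers and $H=\{b_i\to c_i:1\le i\le h\}$ a (possibly empty) set of arrows, such that the distinct integers appearing in $\nu$ or $H$ form $[k]$. A permutation $\sigma\in\mathfrak{S}_n$ contains $(\nu;H)$ if there is a subset $X=\{x_1<\cdots<x_k\}\subseteq[n]$ such that (1) $\sigma_{t_1}\cdots\sigma_{t_m}=x_{a_1}\cdots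 x_{a_m}$ for some indices $t_1<\cdots<t_m$, and (2) $\hat\sigma(x_{b_i})=x_{c_i}$ for all $1\le i\le h$; otherwise $\sigma$ avoids it. In particular, $\sigma$ contains $\alpha=(12;1\to3)$ iff there exist $x_1<x_2<x_3$ in $[n]$ such that $x_1$ appears to the left of $x_2$ in the one-line notation of $\sigma$ and $\hat\sigma(x_1)=x_3$. *)

theory Defs
  imports "HOL-Combinatorics.Combinatorics"
begin

text \<open>
  A permutation of \<open>[n]\<close> is a function \<open>\<sigma> :: nat \<Rightarrow> nat\<close> with \<open>\<sigma> permutes {1..n}\<close>, so its
  one-line notation is \<open>\<sigma> 1 \<dots> \<sigma> n\<close>.  A classical pattern is given by its one-line word,
  whose letters \<open>\<pi> ! 0, \<pi> ! 1, \<dots>\<close> are numbered from 0.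
\<close>

definition contains_pattern :: "nat \<Rightarrow> (nat \<Rightarrow> nat) \<Rightarrow> nat list \<Rightarrow> bool" where
  "contains_pattern n \<sigma> \<pi> \<longleftrightarrow>
     (\<exists>t :: nat \<Rightarrow> nat. strict_mono_on {..<length \<pi>} t \<and> t ` {..<length \<pi>} \<subseteq> {1..n} \<and>
        (\<forall>i<length \<pi>. \<forall>j<length \<pi>. \<sigma> (t i) < \<sigma> (t j) \<longleftrightarrow> \<pi> ! i < \<pi> ! j))"

text \<open>
  \<open>support \<sigma> a\<close> is the list \<open>[a, \<sigma> a, \<sigma> (\<sigma> a), \<dots>]\<close> running once through the cycle of \<open>a\<close>
  (for a fixed point it is \<open>[a]\<close>).  The filter keeps exactly one starting point per cycle,
  namely its maximal element, and lists these maxima increasingly.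
\<close>

definition standard_cycles :: "nat \<Rightarrow> (nat \<Rightarrow> nat) \<Rightarrow> nat list list" where
  "standard_cycles n \<sigma> =
     map (support \<sigma>) (filter (\<lambda>a. a = Max (set (support \<sigma> a))) [1..<Suc n])"

text \<open>
  The value outside \<open>{1..n}\<close> makes \<open>Phi n \<sigma>\<close> a permutation in the sense of \<open>permutes\<close>.
\<close>

definition Phi :: "nat \<Rightarrow> (nat \<Rightarrow> nat) \<Rightarrow> (nat \<Rightarrow> nat)" where
  "Phi n \<sigma> = (\<lambda>i. if i \<in> {1..n} then concat (standard_cycles n \<sigma>) ! (i - 1) else i)"

definition hat :: "nat \<Rightarrow> (nat \<Rightarrow> nat) \<Rightarrow> (nat \<Rightarrow> nat)" where
  "hat n \<sigma> = inv_into {\<tau>. \<tau> permutes {1..n}} (Phi n) \<sigma>"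

text \<open>
  An arrow pattern \<open>(\<nu>; H)\<close> is a pair of a word and a set of arrows, the arrow \<open>b \<rightarrow> c\<close>
  being the pair \<open>(b, c)\<close>.
\<close>

type_synonym arrow_pattern = "nat list \<times> (nat \<times> nat) set"

definition arrow_letters :: "arrow_pattern \<Rightarrow> nat set" where
  "arrow_letters P = set (fst P) \<union> Field (snd P)"

definition arrow_size :: "arrow_pattern \<Rightarrow> nat" where
  "arrow_size P = card (arrow_letters P)"

definition is_arrow_pattern :: "arrow_pattern \<Rightarrow> bool" where
  "is_arrow_pattern P \<longleftrightarrow> arrow_letters P = {1..arrow_size P}"

text \<open>
  The set \<open>X = {x\<^sub>1 < \<dots> < x\<^sub>k}\<close> is represented by its increasing enumeration \<open>x\<close>.  The definition
  is meant for \<open>P\<close> with \<open>is_arrow_pattern P\<close>.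
\<close>

definition contains_arrow :: "nat \<Rightarrow> (nat \<Rightarrow> nat) \<Rightarrow> arrow_pattern \<Rightarrow> bool" where
  "contains_arrow n \<sigma> P \<longleftrightarrow>
     (\<exists>x :: nat \<Rightarrow> nat. strict_mono_on {1..arrow_size P} x \<and> x ` {1..arrow_size P} \<subseteq> {1..n} \<and>
        (\<exists>t :: nat \<Rightarrow> nat. strict_mono_on {..<length (fst P)} t \<and> t ` {..<length (fst P)} \<subseteq> {1..n} \<and>
           (\<forall>j<length (fst P). \<sigma> (t j) = x (fst P ! j))) \<and>
        (\<forall>(b, c)\<in>snd P. hat n \<sigma> (x b) = x c))"

definition alpha :: arrow_pattern where
  "alpha = ([1, 2], {(1, 3)})"

lemma is_arrow_pattern_alpha: "is_arrow_pattern alpha" and arrow_size_alpha: "arrow_size alpha = 3"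
proof -
  have *: "arrow_letters alpha = {1..3}"
    by (auto simp: arrow_letters_def alpha_def Field_def)
  then show "arrow_size alpha = 3"
    by (simp add: arrow_size_def)
  with * show "is_arrow_pattern alpha"
    by (simp add: is_arrow_pattern_def)
qed

definition avoid_count :: "nat \<Rightarrow> nat list \<Rightarrow> arrow_pattern \<Rightarrow> nat" where
  "avoid_count n \<pi> P =
     card {\<sigma>. \<sigma> permutes {1..n} \<and> \<not> contains_pattern n \<sigma> \<pi> \<and> \<not> contains_arrow n \<sigma> P}"

end

theory Submission
  imports Defs
begin

text \<open>
  Write the word of \<open>\<sigma>\<close> as \<open>A @ n # B\<close>.  Avoiding \<open>123\<close> forces \<open>A\<close> to decrease, because an
  ascent followed by \<open>n\<close> is a \<open>123\<close>.  In standard cycle notation every cycle starts at a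
  left-to-right maximum of the word; when \<open>A\<close> decreases, the only ones are the first letters of
  \<open>A\<close> and of \<open>n # B\<close>, so \<open>hat n \<sigma>\<close> has exactly the cycles \<open>A\<close> (unless empty) and \<open>n # B\<close>.  The only
  possible ascent of \<open>hat n \<sigma>\<close> within \<open>A\<close> goes from its last (least) to its first (greatest) letter, so
  as far as \<open>A\<close> is concerned avoiding \<open>alpha\<close> says that no letter of \<open>B\<close> lies in value between
  two letters of \<open>A\<close>.  Within \<open>B\<close>, where \<open>hat n \<sigma>\<close> sends each letter to the next one, it
  says that no adjacent ascent is followed by a letter of intermediate value.  Given that \<open>B\<close>
  avoids \<open>123\<close>, this is the same as avoiding \<open>132\<close>; avoiding both means that no letter of \<open>B\<close>
  has two larger letters to its right.  What remains of avoiding \<open>123\<close> is that the letters of \<open>B\<close> above some letter of \<open>A\<close> decrease.  These conditions are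
  collected in \<open>good_split\<close>, and \<open>avoids_iff_good_split\<close> proves the equivalence.

  The pairs \<open>(A, B)\<close> are counted for the letters \<open>{m..n}\<close>, with \<open>m\<close> descending from \<open>n\<close> to
  \<open>1\<close>.  If the least letter \<open>m\<close> lies in \<open>A\<close>, then \<open>A\<close> consists of the letters
  \<open>q, \<dots>, m\<close> for some \<open>q < n\<close>, and \<open>B\<close> is forced to be decreasing: this gives \<open>n - m\<close>
  pairs.  If \<open>m\<close> lies in \<open>B\<close>, then it has at most one letter to its right, and deleting it is
  harmless; so a pair on \<open>{m + 1..n}\<close> extends in two ways, except that the single pair with
  empty \<open>B\<close> extends in only one way.  With \<open>k = n - m + 1\<close> letters the numbers \<open>c k\<close> of
  pairs therefore satisfy \<open>c k = 2 * c (k - 1) - 1 + (k - 1)\<close> and \<open>c 1 = 1\<close>, whence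
  \<open>c k = 2 ^ k - k\<close>.

  To work with \<open>hat\<close> at all one needs that \<open>Phi\<close> is a bijection.  It maps permutations to
  permutations, so injectivity suffices; and the cycles can be recovered from the word because they
  are cut exactly at the left-to-right maxima (\<open>std_blocks_unique\<close>).
\<close>

section \<open>Standard cycle notation\<close>

text \<open>
  The shape of a standard cycle notation, independently of any permutation: every block starts with
  its strict maximum, and these maxima increase.
\<close>

fun std_blocks :: "nat list list \<Rightarrow> bool" where
  "std_blocks [] \<longleftrightarrow> True"
| "std_blocks (c # cs) \<longleftrightarrow> c \<noteq> [] \<and> (\<forall>x\<in>set (tl c). x < hd c) \<and> (\<forall>d\<in>set cs. hd c < hd d) \<and> std_blocks cs"

text \<open>
  The block after the first one starts with a letter larger than \<open>m\<close>, so reading on from \<open>m\<close> up to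
  the next larger letter recovers the first block.
\<close>

lemma takeWhile_first_block:
  assumes "std_blocks ((m # c) # cs)"
  shows "takeWhile (\<lambda>x. x < m) (c @ concat cs) = c"
proof -
  have "takeWhile (\<lambda>x. x < m) (concat cs) = []"
  proof (cases cs)
    case (Cons d ds)
    then show ?thesis using assms by (cases d) auto
  qed simp
  moreover have "\<forall>x\<in>set c. x < m" using assms by simp
  ultimately show ?thesis by simp
qed

text \<open>
  Erasing the parentheses loses no information: peel off the first block, which is determined by the
  word alone, and recurse.
\<close>

lemma std_blocks_unique:
  "std_blocks cs \<Longrightarrow> std_blocks ds \<Longrightarrow> concat cs = concat ds \<Longrightarrow> cs = ds"
proof (induction cs arbitrary: ds)
  case Nil
  then show ?case by (cases ds) auto
next
  case (Cons c cs)
  then obtain d ds' where ds: "ds = d # ds'" by (cases ds) auto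
  obtain m c' where c: "c = m # c'" using Cons.prems(1) by (cases c) auto
  obtain k d' where d: "d = k # d'" using Cons.prems(2) ds by (cases d) auto
  have eq: "k = m" "c' @ concat cs = d' @ concat ds'"
    using Cons.prems(3) by (auto simp: c d ds)
  have "c' = d'"
    using takeWhile_first_block[of m c' cs] takeWhile_first_block[of m d' ds'] Cons.prems eq
    by (simp add: c d ds)
  then show ?case using Cons eq by (simp add: c d ds)
qed

lemma hd_support:
  assumes "permutation p"
  shows "support p a \<noteq> []" "hd (support p a) = a"
  using least_power_of_permutation(2)[OF assms, of a] by (auto simp: hd_map)

lemma standard_cycles_step:
  assumes p: "permutation p" and c: "c \<in> set (standard_cycles n p)" and i: "i < length c"
  shows "p (c ! i) = c ! (Suc i mod length c)"
proof -
  obtain a where a: "c = support p a" using c by (auto simp: standard_cycles_def)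
  show ?thesis
  proof (cases "Suc i < length c")
    case True
    then show ?thesis by (simp add: a)
  next
    case False
    with i have e: "least_power p a = Suc i" by (simp add: a)
    have "(p ^^ Suc i) a = a" using least_power_of_permutation(1)[OF p, of a] unfolding e .
    then show ?thesis by (simp add: a e del: upt_Suc)
  qed
qed

lemma std_blocks_standard_cycles:
  assumes p: "permutation p"
  shows "std_blocks (standard_cycles n p)"
proof -
  have *: "std_blocks (map (support p) as)"
    if "sorted_wrt (<) as" "\<forall>a\<in>set as. a = Max (set (support p a))" for as
    using that
  proof (induction as)
    case (Cons a as)
    have "x < hd (support p a)" if x: "x \<in> set (tl (support p a))" for x
    proof -
      have "distinct (support p a)" by (rule cycle_of_permutation[OF p])
      then have "distinct (a # tl (support p a))"
        using hd_support[OF p, of a] by (metis list.collapse)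
      then have "x \<noteq> a" using x by auto
      moreover have "x \<le> Max (set (support p a))"
        by (rule Max_ge[OF finite_set list.set_sel(2)[OF hd_support(1)[OF p] x]])
      ultimately show ?thesis using Cons.prems hd_support(2)[OF p, of a] by auto
    qed
    then show ?case
      using Cons hd_support[OF p] by auto
  qed simp
  show ?thesis unfolding standard_cycles_def
    by (rule *) (auto intro: sorted_wrt_filter simp del: upt_Suc)
qed

text \<open>
  Supports are either disjoint or equal as sets, and the choice of the maximum as starting point picks
  one from each class, so the cycles together list every letter exactly once.
\<close>

lemma standard_cycles_word:
  assumes p: "p permutes {1..n}"
  shows "distinct (concat (standard_cycles n p))" "set (concat (standard_cycles n p)) = {1..n}"
proof -
  have perm: "permutation p" by (rule permutes_imp_permutation[OF _ p]) simp
  let ?as = "filter (\<lambda>a. a = Max (set (support p a))) [1..<Suc n]"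
  have inj: "inj (support p)" by (rule inj_on_inverseI[where g = hd]) (rule hd_support(2)[OF perm])
  have "distinct (map (support p) ?as)"
    unfolding distinct_map using inj by (auto intro: inj_on_subset simp del: upt_Suc)
  moreover have "set c \<inter> set d = {}"
    if cd: "c \<in> set (map (support p) ?as)" "d \<in> set (map (support p) ?as)" "c \<noteq> d" for c d
  proof -
    \<comment> \<open>A cycle is determined by its set of letters, since it starts at their maximum.\<close>
    have max: "\<exists>a. c = support p a \<and> a = Max (set c)" if "c \<in> set (map (support p) ?as)" for c
      using that unfolding set_map[of "support p"] set_filter by blast
    obtain a b where ab: "c = support p a" "a = Max (set c)" "d = support p b" "b = Max (set d)"
      using max[OF cd(1)] max[OF cd(2)] by blast
    then have "set c \<noteq> set d" using cd(3) by metis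
    then show ?thesis
      using disjointD[OF disjoint_support[OF perm] rangeI rangeI] unfolding ab(1,3) by blast
  qed
  ultimately show "distinct (concat (standard_cycles n p))"
    unfolding standard_cycles_def
    by (intro distinct_concat) (auto intro: cycle_of_permutation[OF perm] simp del: upt_Suc)
  have sub: "set (support p a) \<subseteq> {1..n}" if "a \<in> {1..n}" for a
    unfolding support_set[OF perm]
    using permutes_in_image[OF permutes_funpow[OF p]] that by blast
  have "x \<in> set (concat (standard_cycles n p))" if x: "x \<in> {1..n}" for x
  proof -
    define a where "a = Max (set (support p x))"
    have "a \<in> set (support p x)"
      unfolding a_def using hd_support(1)[OF perm, of x] by (intro Max_in) auto
    then have a: "a \<in> {1..n}" "set (support p a) \<inter> set (support p x) \<noteq> {}"
      using sub[OF x] disjoint_support'[OF perm] by blast+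
    then have eq: "set (support p a) = set (support p x)"
      using disjointD[OF disjoint_support[OF perm] rangeI rangeI] by blast
    have "x \<in> set (support p x)"
      using hd_support[OF perm, of x] list.set_sel(1) by metis
    then have "x \<in> set (support p a)" unfolding eq .
    moreover have "a = Max (set (support p a))" unfolding eq by (rule a_def)
    with a(1) have "a \<in> set ?as"
      unfolding set_filter set_upt atLeastLessThanSuc_atLeastAtMost by blast
    then have "support p a \<in> set (standard_cycles n p)"
      unfolding standard_cycles_def set_map[of "support p"] by (rule imageI)
    ultimately show ?thesis unfolding set_concat by blast
  qed
  moreover have "set (concat (standard_cycles n p)) \<subseteq> {1..n}"
  proof -
    have "\<exists>a\<in>{1..n}. c = support p a" if "c \<in> set (standard_cycles n p)" for c
      using that
      unfolding standard_cycles_def set_map[of "support p"] set_filter set_upt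
        atLeastLessThanSuc_atLeastAtMost by blast
    then show ?thesis unfolding set_concat using sub by blast
  qed
  ultimately show "set (concat (standard_cycles n p)) = {1..n}" by blast
qed

section \<open>One-line notation and the bijection \<open>Phi\<close>\<close>

abbreviation one_line :: "nat \<Rightarrow> (nat \<Rightarrow> nat) \<Rightarrow> nat list" where
  "one_line n \<sigma> \<equiv> map \<sigma> [1..<Suc n]"

definition perm_of_word :: "nat \<Rightarrow> nat list \<Rightarrow> nat \<Rightarrow> nat" where
  "perm_of_word n w = (\<lambda>i. if i \<in> {1..n} then w ! (i - 1) else i)"

lemma one_line_perm_of_word:
  assumes "distinct w" "set w = {1..n}"
  shows "one_line n (perm_of_word n w) = w"
proof -
  have "length w = n" using assms distinct_card by fastforce
  then show ?thesis
    by (intro nth_equalityI) (auto simp: perm_of_word_def simp del: upt_Suc)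
qed

lemma perm_of_word_permutes:
  assumes "distinct w" "set w = {1..n}"
  shows "perm_of_word n w permutes {1..n}"
proof (rule bij_imp_permutes)
  have "distinct (one_line n (perm_of_word n w))" "set (one_line n (perm_of_word n w)) = {1..n}"
    using assms one_line_perm_of_word by metis+
  then show "bij_betw (perm_of_word n w) {1..n} {1..n}"
    unfolding distinct_map bij_betw_def set_map set_upt atLeastLessThanSuc_atLeastAtMost by blast
qed (auto simp: perm_of_word_def)

lemma one_line_inj:
  assumes "p permutes {1..n}" "q permutes {1..n}" "one_line n p = one_line n q"
  shows "p = q"
proof
  fix x
  have "\<forall>x\<in>{1..n}. p x = q x" using assms(3)
    unfolding map_eq_conv set_upt atLeastLessThanSuc_atLeastAtMost .
  then show "p x = q x" using assms(1,2) permutes_not_in by metis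
qed

lemma one_line_word:
  assumes "p permutes {1..n}"
  shows "distinct (one_line n p)" "set (one_line n p) = {1..n}"
  using permutes_image[OF assms] permutes_inj_on[OF assms]
  by (auto simp: distinct_map atLeastLessThanSuc_atLeastAtMost simp del: upt_Suc)

lemma one_line_Phi:
  assumes "p permutes {1..n}"
  shows "Phi n p permutes {1..n}" "one_line n (Phi n p) = concat (standard_cycles n p)"
proof -
  have "Phi n p = perm_of_word n (concat (standard_cycles n p))"
    by (simp add: Phi_def perm_of_word_def)
  then show "Phi n p permutes {1..n}" "one_line n (Phi n p) = concat (standard_cycles n p)"
    using perm_of_word_permutes one_line_perm_of_word standard_cycles_word[OF assms] by metis+
qed

text \<open>
  Equal images have equal standard cycles by \<open>std_blocks_unique\<close>, and a permutation can be read off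
  its cycles.
\<close>

lemma Phi_inj: "inj_on (Phi n) {p. p permutes {1..n}}"
proof (rule inj_onI)
  fix p q assume "p \<in> {p. p permutes {1..n}}" "q \<in> {p. p permutes {1..n}}" and eq: "Phi n p = Phi n q"
  then have p: "p permutes {1..n}" and q: "q permutes {1..n}" by simp_all
  have perm: "permutation p" "permutation q"
    using permutes_imp_permutation[OF finite_atLeastAtMost] p q by blast+
  have cyc: "standard_cycles n p = standard_cycles n q"
    using std_blocks_unique std_blocks_standard_cycles perm one_line_Phi(2) p q eq by metis
  show "p = q"
  proof
    fix x show "p x = q x"
    proof (cases "x \<in> {1..n}")
      case True
      then obtain c where c: "c \<in> set (standard_cycles n p)" "x \<in> set c"
        using standard_cycles_word(2)[OF p] unfolding set_concat by blast
      then obtain i where "i < length c" "x = c ! i" by (metis in_set_conv_nth)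
      then show ?thesis using standard_cycles_step perm c(1) cyc by metis
    next
      case False then show ?thesis using p q permutes_not_in by metis
    qed
  qed
qed

text \<open>
  An injective self-map of a finite set is onto, so the inverse image chosen in \<open>hat\<close> exists and has
  the word of \<open>\<sigma>\<close> as its erased cycle notation.
\<close>

lemma hat_standard_cycles:
  assumes "\<sigma> permutes {1..n}"
  shows "hat n \<sigma> permutes {1..n}" "concat (standard_cycles n (hat n \<sigma>)) = one_line n \<sigma>"
proof -
  let ?S = "{p. p permutes {1..n}}"
  have "Phi n ` ?S = ?S"
  proof (rule endo_inj_surj)
    show "finite ?S" by (rule finite_permutations) simp
    show "Phi n ` ?S \<subseteq> ?S" by (intro image_subsetI CollectI one_line_Phi(1)) simp
  qed (rule Phi_inj)
  then have mem: "\<sigma> \<in> Phi n ` ?S" using assms by simp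
  then show h: "hat n \<sigma> permutes {1..n}"
    unfolding hat_def using inv_into_into[of \<sigma> "Phi n" ?S] by simp
  have "Phi n (hat n \<sigma>) = \<sigma>" unfolding hat_def by (rule f_inv_into_f[OF mem])
  then show "concat (standard_cycles n (hat n \<sigma>)) = one_line n \<sigma>"
    using one_line_Phi(2)[OF h] by simp
qed

section \<open>Avoidance as a property of words\<close>

text \<open>
  The ternary counterpart of \<^const>\<open>sorted_wrt\<close>: \<open>P\<close> holds for all triples of letters taken in order
  of position.  Avoidance of a pattern with three letters has this form, and it splits well over
  concatenation.
\<close>

fun triplewise :: "('a \<Rightarrow> 'a \<Rightarrow> 'a \<Rightarrow> bool) \<Rightarrow> 'a list \<Rightarrow> bool" where
  "triplewise P [] \<longleftrightarrow> True"
| "triplewise P (x # xs) \<longleftrightarrow> sorted_wrt (P x) xs \<and> triplewise P xs"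

lemma triplewise_append:
  "triplewise P (xs @ ys) \<longleftrightarrow> triplewise P xs \<and> triplewise P ys \<and>
     (\<forall>x\<in>set xs. sorted_wrt (P x) ys) \<and> (\<forall>y\<in>set ys. sorted_wrt (\<lambda>x x'. P x x' y) xs)"
  by (induction xs) (auto simp: sorted_wrt_append)

lemma triplewise_iff_nth:
  "triplewise P xs \<longleftrightarrow>
     (\<forall>i j k. i < j \<longrightarrow> j < k \<longrightarrow> k < length xs \<longrightarrow> P (xs ! i) (xs ! j) (xs ! k))"
  by (induction xs) (auto simp: sorted_wrt_iff_nth_less nth_Cons split: nat.split)

lemma one_line_nth: "i < n \<Longrightarrow> one_line n \<sigma> ! i = \<sigma> (Suc i)"
  by (simp del: upt_Suc)

lemma contains_123_iff:
  "contains_pattern n \<sigma> [1, 2, 3] \<longleftrightarrow> \<not> triplewise (\<lambda>x y z. \<not> (x < y \<and> y < z)) (one_line n \<sigma>)"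
proof
  assume "contains_pattern n \<sigma> [1, 2, 3]"
  then obtain t where t: "strict_mono_on {..<3} t" "t ` {..<3} \<subseteq> {1..n}"
      "\<forall>i<3. \<forall>j<3. \<sigma> (t i) < \<sigma> (t j) \<longleftrightarrow> [1::nat, 2, 3] ! i < [1, 2, 3] ! j"
    unfolding contains_pattern_def by (auto simp: numeral_3_eq_3)
  have "t 0 < t 1" "t 1 < t 2" using t(1) by (auto simp: strict_mono_on_def)
  moreover have "t 0 \<in> {1..n}" "t 1 \<in> {1..n}" "t 2 \<in> {1..n}" using t(2) by (simp_all add: image_subset_iff)
  moreover have "\<sigma> (t 0) < \<sigma> (t 1)" "\<sigma> (t 1) < \<sigma> (t 2)"
    using t(3)[rule_format, of 0 1] t(3)[rule_format, of 1 2] by simp_all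
  ultimately have "t 0 - 1 < t 1 - 1" "t 1 - 1 < t 2 - 1" "t 2 - 1 < length (one_line n \<sigma>)"
      "one_line n \<sigma> ! (t 0 - 1) < one_line n \<sigma> ! (t 1 - 1)"
      "one_line n \<sigma> ! (t 1 - 1) < one_line n \<sigma> ! (t 2 - 1)"
    by (auto simp: one_line_nth simp del: upt_Suc)
  then show "\<not> triplewise (\<lambda>x y z. \<not> (x < y \<and> y < z)) (one_line n \<sigma>)"
    unfolding triplewise_iff_nth by blast
next
  assume "\<not> triplewise (\<lambda>x y z. \<not> (x < y \<and> y < z)) (one_line n \<sigma>)"
  then obtain i j k where ijk: "i < j" "j < k" "k < n"
      "\<sigma> (Suc i) < \<sigma> (Suc j)" "\<sigma> (Suc j) < \<sigma> (Suc k)"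
    unfolding triplewise_iff_nth by (auto simp: one_line_nth simp del: upt_Suc)
  then show "contains_pattern n \<sigma> [1, 2, 3]"
    unfolding contains_pattern_def
    by (intro exI[of _ "\<lambda>l. [Suc i, Suc j, Suc k] ! l"])
      (auto simp: strict_mono_on_def less_Suc_eq nth_Cons split: nat.splits)
qed

text \<open>
  The third letter of an occurrence of \<open>alpha\<close> is the image of the first one, so that only a
  condition on pairs of positions is left.
\<close>

lemma contains_alpha_iff:
  assumes \<sigma>: "\<sigma> permutes {1..n}"
  shows "contains_arrow n \<sigma> alpha \<longleftrightarrow>
     \<not> sorted_wrt (\<lambda>x y. \<not> (x < y \<and> y < hat n \<sigma> x)) (one_line n \<sigma>)"
proof
  assume "contains_arrow n \<sigma> alpha"
  then obtain x t :: "nat \<Rightarrow> nat" where x: "strict_mono_on {1..3} x"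
    and t: "strict_mono_on {..<2} t" "t ` {..<2} \<subseteq> {1..n}" "\<forall>j<2. \<sigma> (t j) = x ([1, 2] ! j)"
    and h: "hat n \<sigma> (x 1) = x 3"
    unfolding contains_arrow_def arrow_size_alpha by (auto simp: alpha_def simp flip: numeral_2_eq_2)
  have "x 1 < x 2" "x 2 < x 3" using x by (auto simp: strict_mono_on_def)
  moreover have "\<sigma> (t 0) = x 1" "\<sigma> (t 1) = x 2"
    using t(3)[rule_format, of 0] t(3)[rule_format, of 1] by simp_all
  moreover have "t 0 < t 1" "t 0 \<in> {1..n}" "t 1 \<in> {1..n}"
    using t(1,2) by (simp_all add: strict_mono_on_def image_subset_iff)
  ultimately have "t 0 - 1 < t 1 - 1" "t 1 - 1 < length (one_line n \<sigma>)"
      "one_line n \<sigma> ! (t 0 - 1) < one_line n \<sigma> ! (t 1 - 1)"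
      "one_line n \<sigma> ! (t 1 - 1) < hat n \<sigma> (one_line n \<sigma> ! (t 0 - 1))"
    using h by (auto simp: one_line_nth simp del: upt_Suc)
  then show "\<not> sorted_wrt (\<lambda>x y. \<not> (x < y \<and> y < hat n \<sigma> x)) (one_line n \<sigma>)"
    unfolding sorted_wrt_iff_nth_less by blast
next
  assume "\<not> sorted_wrt (\<lambda>x y. \<not> (x < y \<and> y < hat n \<sigma> x)) (one_line n \<sigma>)"
  then obtain i j where ij: "i < j" "j < n"
      "\<sigma> (Suc i) < \<sigma> (Suc j)" "\<sigma> (Suc j) < hat n \<sigma> (\<sigma> (Suc i))"
    unfolding sorted_wrt_iff_nth_less by (auto simp: one_line_nth simp del: upt_Suc)
  define x where "x l = [\<sigma> (Suc i), \<sigma> (Suc j), hat n \<sigma> (\<sigma> (Suc i))] ! (l - 1)" for l :: nat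
  have x: "x 1 = \<sigma> (Suc i)" "x 2 = \<sigma> (Suc j)" "x 3 = hat n \<sigma> (\<sigma> (Suc i))"
    by (simp_all add: x_def)
  have *: "{1..3} = {1, 2, 3 :: nat}" "{..<2} = {0, 1 :: nat}" by auto
  have "x 1 \<in> {1..n}" "x 2 \<in> {1..n}"
    unfolding x permutes_in_image[OF \<sigma>] using ij by auto
  moreover have "x 3 \<in> {1..n}"
    unfolding x permutes_in_image[OF hat_standard_cycles(1)[OF \<sigma>]] permutes_in_image[OF \<sigma>] using ij by auto
  ultimately have 1: "x ` {1..3} \<subseteq> {1..n}" unfolding * by blast
  have 2: "strict_mono_on {1..3} x"
    unfolding * strict_mono_on_def using ij x by auto
  have 3: "strict_mono_on {..<2} (\<lambda>l. [Suc i, Suc j] ! l)" "(\<lambda>l. [Suc i, Suc j] ! l) ` {..<2} \<subseteq> {1..n}"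
    "\<forall>l<2. \<sigma> ([Suc i, Suc j] ! l) = x ([1, 2] ! l)"
    unfolding * strict_mono_on_def using ij x by (auto simp: less_2_cases_iff)
  have 4: "length [1, 2 :: nat] = 2" "fst alpha = [1,2]" "snd alpha = {(1,3)}" by (simp_all add: alpha_def)
  have 5: "\<forall>(b, c)\<in>{(1, 3)}. hat n \<sigma> (x b) = x c" using x by simp
  show "contains_arrow n \<sigma> alpha"
    unfolding contains_arrow_def arrow_size_alpha 4
    by (rule exI[of _ x], intro conjI 1 2 5, rule exI[of _ "\<lambda>l. [Suc i, Suc j] ! l"], intro conjI 3)
qed

section \<open>Structure of the avoiding permutations\<close>

text \<open>
  The pair \<open>(A, B)\<close> stands for the word \<open>A @ n # B\<close>.  The second conjunct excludes a \<open>123\<close> that starts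
  in \<open>A\<close> and continues in \<open>B\<close>, the third an occurrence of \<open>alpha\<close> that starts in \<open>A\<close>, and the
  last one both patterns \<open>123\<close> and \<open>132\<close> in \<open>B\<close>.
\<close>

definition good_split :: "nat list \<Rightarrow> nat list \<Rightarrow> bool" where
  "good_split A B \<longleftrightarrow>
     sorted_wrt (>) A \<and>
     (\<forall>a\<in>set A. sorted_wrt (\<lambda>x y. \<not> (a < x \<and> x < y)) B) \<and>
     (\<forall>a\<in>set A. \<forall>a'\<in>set A. \<forall>b\<in>set B. \<not> (a < b \<and> b < a')) \<and>
     triplewise (\<lambda>x y z. \<not> (x < y \<and> x < z)) B"

text \<open>
  In a word in which \<open>f\<close> moves each letter to its right neighbour, the arrow pattern only forbids the
  pattern \<open>132\<close> whose first two letters are adjacent.  But any \<open>132\<close> yields such an adjacent one: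
  between its \<open>1\<close> and its \<open>3\<close> the word must at some step jump over the value of the \<open>2\<close>.
\<close>

lemma avoids_123_132_iff_adjacent:
  assumes B: "distinct B" and f: "\<And>i. Suc i < length B \<Longrightarrow> f (B ! i) = B ! Suc i"
  shows "triplewise (\<lambda>x y z. \<not> (x < y \<and> y < z)) B \<and> sorted_wrt (\<lambda>x y. \<not> (x < y \<and> y < f x)) B \<longleftrightarrow>
    triplewise (\<lambda>x y z. \<not> (x < y \<and> x < (z::nat))) B" (is "?T \<and> ?S \<longleftrightarrow> ?R")
proof (intro iffI conjI)
  assume TS: "?T \<and> ?S"
  show ?R unfolding triplewise_iff_nth
  proof (intro allI impI notI)
    fix i j k assume ijk: "i < j" "j < k" "k < length B" and lt: "B ! i < B ! j \<and> B ! i < B ! k"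
    have "\<not> B ! j < B ! k" using TS ijk lt unfolding triplewise_iff_nth by blast
    moreover have "B ! j \<noteq> B ! k" using B ijk by (simp add: nth_eq_iff_index_eq)
    ultimately have j: "B ! k < B ! j" by simp
    \<comment> \<open>the end of the first jump over the value \<open>B ! k\<close>\<close>
    define v where "v = (LEAST v. i < v \<and> B ! k < B ! v)"
    have v: "i < v" "B ! k < B ! v" "v \<le> j"
      using LeastI[of "\<lambda>v. i < v \<and> B ! k < B ! v" j] Least_le[of "\<lambda>v. i < v \<and> B ! k < B ! v" j] j ijk
      unfolding v_def by auto
    have "B ! (v - 1) \<le> B ! k"
    proof (cases "i < v - 1")
      case True
      then show ?thesis
        using not_less_Least[of "v - 1" "\<lambda>v. i < v \<and> B ! k < B ! v"] unfolding v_def[symmetric] by auto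
    next
      case False
      then have "v - 1 = i" using v(1) by linarith
      then show ?thesis using lt by simp
    qed
    moreover have "B ! (v - 1) \<noteq> B ! k" using B ijk v by (auto simp: nth_eq_iff_index_eq)
    moreover have "f (B ! (v - 1)) = B ! v" using f[of "v - 1"] v ijk by auto
    moreover have "v - 1 < k" using v ijk by linarith
    ultimately show False
      using TS ijk v(2) unfolding sorted_wrt_iff_nth_less by (metis le_neq_implies_less)
  qed
next
  assume R: ?R
  then show ?T unfolding triplewise_iff_nth by (meson less_trans)
  show ?S unfolding sorted_wrt_iff_nth_less
  proof (intro allI impI notI)
    fix i j assume ij: "i < j" "j < length B" and lt: "B ! i < B ! j \<and> B ! j < f (B ! i)"
    have fi: "f (B ! i) = B ! Suc i" using f ij by simp
    with lt have "Suc i \<noteq> j" by auto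
    with ij have "Suc i < j" by simp
    then show False using R ij lt fi unfolding triplewise_iff_nth by (metis lessI less_trans)
  qed
qed

text \<open>
  Avoiding \<open>123\<close> is split over the concatenation \<open>A @ n # B\<close>.  Once \<open>A\<close> is known to decrease, the
  cycles of \<open>hat n \<sigma>\<close> are \<open>A\<close> and \<open>n # B\<close>, which turns the arrow condition into conditions on \<open>A\<close>
  and \<open>B\<close> separately.
\<close>

lemma avoids_iff_good_split:
  assumes \<sigma>: "\<sigma> permutes {1..n}" and w: "one_line n \<sigma> = A @ n # B"
  shows "\<not> contains_pattern n \<sigma> [1, 2, 3] \<and> \<not> contains_arrow n \<sigma> alpha \<longleftrightarrow> good_split A B"
proof -
  let ?f = "hat n \<sigma>"
  let ?Q = "\<lambda>x y. \<not> (x < y \<and> y < ?f x)"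
  have dist: "distinct (A @ n # B)" and set: "set (A @ n # B) = {1..n}"
    using one_line_word[OF \<sigma>] unfolding w by blast+
  have lt: "a < n" if "a \<in> set A \<union> set B" for a
  proof -
    have "a \<le> n" using that set by auto
    moreover have "a \<noteq> n" using that dist by auto
    ultimately show ?thesis by simp
  qed
  have fle: "?f x \<le> n" if "x \<in> set A \<union> set B \<union> {n}" for x
    using permutes_in_image[OF hat_standard_cycles(1)[OF \<sigma>], of x] that set by auto
  have distA: "distinct A" using dist by simp
  have A: "sorted_wrt (\<lambda>x x'. \<not> (x < x' \<and> x' < n)) A \<longleftrightarrow> sorted_wrt (>) A"
    unfolding sorted_wrt_iff_nth_less using distA lt
    by (metis UnI1 linorder_neqE_nat nth_eq_iff_index_eq nth_mem order_less_asym less_trans)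
  have 123: "\<not> contains_pattern n \<sigma> [1, 2, 3] \<longleftrightarrow> sorted_wrt (>) A \<and>
      (\<forall>a\<in>set A. sorted_wrt (\<lambda>x y. \<not> (a < x \<and> x < y)) B) \<and>
      triplewise (\<lambda>x y z. \<not> (x < y \<and> y < z)) B"
  proof -
    have nB: "sorted_wrt (\<lambda>y z. \<not> (n < y \<and> y < z)) B"
      using lt unfolding sorted_wrt_iff_nth_less by (meson UnI2 less_asym less_trans nth_mem)
    have dec: "triplewise (\<lambda>x y z. \<not> (x < y \<and> y < z)) A"
              "\<forall>y. sorted_wrt (\<lambda>x x'. \<not> (x < x' \<and> x' < y)) A" if "sorted_wrt (>) A"
      using that less_asym unfolding sorted_wrt_iff_nth_less triplewise_iff_nth
      by (meson less_trans)+
    have "\<not> n < b" if "b \<in> set B" for b using lt[of b] that by simp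
    then show ?thesis
      unfolding contains_123_iff w triplewise_append not_not
      using A nB dec by auto
  qed
  have Q: "(sorted_wrt ?Q (A @ n # B)) \<longleftrightarrow>
      (\<forall>a\<in>set A. \<forall>a'\<in>set A. \<forall>b\<in>set B. \<not> (a < b \<and> b < a')) \<and> sorted_wrt ?Q B"
     and step: "\<And>i. Suc i < length B \<Longrightarrow> ?f (B ! i) = B ! Suc i"
    if dec: "sorted_wrt (>) A"
  proof -
    have perm: "permutation ?f" by (rule permutes_imp_permutation[OF _ hat_standard_cycles(1)[OF \<sigma>]]) simp
    \<comment> \<open>For empty \<open>A\<close> there is no cycle in front of that of \<open>n\<close>.\<close>
    define cs where "cs = (if A = [] then [] else [A]) @ [n # B]"
    have "std_blocks cs"
      using lt dec by (cases A) (auto simp: cs_def)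
    moreover have "concat cs = A @ n # B" by (simp add: cs_def)
    ultimately have cyc: "standard_cycles n ?f = cs"
      using std_blocks_unique std_blocks_standard_cycles[OF perm] hat_standard_cycles(2)[OF \<sigma>] w by metis
    show "?f (B ! i) = B ! Suc i" if "Suc i < length B" for i
      using standard_cycles_step[OF perm, of "n # B" n "Suc i"] that by (simp add: cyc cs_def)
    have fA: "?f (A ! i) = A ! (Suc i mod length A)" if "i < length A" for i
      using standard_cycles_step[OF perm, of A n i] that by (cases "A = []") (simp_all add: cyc cs_def)
    have QA: "sorted_wrt ?Q A" using dec unfolding sorted_wrt_iff_nth_less by (meson less_asym)
    have AB: "(\<forall>a\<in>set A. \<forall>b\<in>set B. ?Q a b) \<longleftrightarrow>
        (\<forall>a\<in>set A. \<forall>a'\<in>set A. \<forall>b\<in>set B. \<not> (a < b \<and> b < a'))" (is "?L \<longleftrightarrow> ?R")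
    proof
      assume L: ?L
      show ?R
      proof (intro ballI notI)
        fix a a' b assume a: "a \<in> set A" "a' \<in> set A" and b: "b \<in> set B" and ab: "a < b \<and> b < a'"
        have ne: "A \<noteq> []" using a by auto
        obtain i i' where i: "i < length A" "a = A ! i" "i' < length A" "a' = A ! i'"
          using a by (metis in_set_conv_nth)
        have last: "A ! (length A - 1) \<le> a"
          using dec i ne unfolding sorted_wrt_iff_nth_less
          by (cases "i = length A - 1") (auto intro!: less_imp_le)
        have first: "a' \<le> A ! 0"
          using dec i ne unfolding sorted_wrt_iff_nth_less
          by (cases "i' = 0") (auto intro!: less_imp_le)
        \<comment> \<open>the only ascent of \<open>hat n \<sigma>\<close> in \<open>A\<close>, from its minimum to its maximum\<close>
        have "?f (A ! (length A - 1)) = A ! 0" using fA[of "length A - 1"] ne by simp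
        moreover have "A ! (length A - 1) \<in> set A" using ne by simp
        ultimately show False using L b ab last first by (metis le_less_trans less_le_trans)
      qed
    next
      assume R: ?R
      have "?f a \<in> set A" if "a \<in> set A" for a
        using that fA by (metis in_set_conv_nth length_pos_if_in_set mod_less_divisor nth_mem)
      then show ?L using R by blast
    qed
    have ltB: "b \<le> n" if "b \<in> set B" for b using lt[of b] that by simp
    show "(sorted_wrt ?Q (A @ n # B)) \<longleftrightarrow>
      (\<forall>a\<in>set A. \<forall>a'\<in>set A. \<forall>b\<in>set B. \<not> (a < b \<and> b < a')) \<and> sorted_wrt ?Q B"
      unfolding sorted_wrt_append AB[symmetric] using QA ltB fle by (auto simp: not_less)
  qed
  show ?thesis
  proof (cases "sorted_wrt (>) A")
    case True
    have "distinct B" using dist by simp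
    then have "triplewise (\<lambda>x y z. \<not> (x < y \<and> y < z)) B \<and> sorted_wrt ?Q B \<longleftrightarrow>
        triplewise (\<lambda>x y z. \<not> (x < y \<and> x < z)) B"
      using step[OF True] by (rule avoids_123_132_iff_adjacent)
    then show ?thesis
      unfolding 123 contains_alpha_iff[OF \<sigma>] w good_split_def not_not Q[OF True] by argo
  next
    case False
    then show ?thesis unfolding 123 good_split_def by argo
  qed
qed

section \<open>Counting by removal of the least letter\<close>

text \<open>
  The lower end of the letters is a parameter, so that removing the least letter needs no
  renumbering.
\<close>

definition good_splits :: "nat \<Rightarrow> nat \<Rightarrow> (nat list \<times> nat list) set" where
  "good_splits n m = {(A, B). distinct (A @ n # B) \<and> set (A @ n # B) = {m..n} \<and> good_split A B}"

lemma decreasing_eq_rev_upt: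
  assumes "sorted_wrt (>) xs" "set xs = {a..<b}"
  shows "xs = rev [a..<b]"
proof -
  have "rev xs = [a..<b]"
    by (rule strict_sorted_equal) (use assms in \<open>auto simp: sorted_wrt_rev\<close>)
  then show ?thesis by (metis rev_rev_ident)
qed


lemma inj_join: "inj_on (\<lambda>(A, B). A @ n # B) (good_splits n m)"
proof (rule inj_onI, clarify)
  fix A B C D assume G: "(A, B) \<in> good_splits n m" and eq: "A @ n # B = C @ n # D"
  have "n \<notin> set A" "n \<notin> set B" using G by (simp_all add: good_splits_def)
  then show "A = C \<and> B = D" using eq by (simp add: append_Cons_eq_iff)
qed

lemma good_splits_base: "good_splits n n = {([], [])}"
proof -
  have "A = [] \<and> B = []" if "distinct (A @ n # B)" "set (A @ n # B) = {n}" for A B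
    using that by (cases A; cases B) auto
  then show ?thesis by (auto simp: good_splits_def good_split_def)
qed

lemma finite_good_splits: "finite (good_splits n m)"
proof (rule finite_imageD[OF _ inj_join])
  have "(\<lambda>(A, B). A @ n # B) ` good_splits n m \<subseteq> {w. set w \<subseteq> {m..n} \<and> distinct w}"
    unfolding good_splits_def by (intro image_subsetI) fastforce
  then show "finite ((\<lambda>(A, B). A @ n # B) ` good_splits n m)"
    by (rule finite_subset) (simp add: finite_subset_distinct)
qed

lemma letters_of_split:
  fixes A B :: "nat list"
  assumes "distinct (A @ n # B)" "set (A @ n # B) = {m..n}"
  shows "set A \<union> set B = {m..<n}"
proof -
  have "set A \<union> set B = {m..n} - {n}" using assms by auto
  also have "\<dots> = {m..<n}" by auto
  finally show ?thesis .
qed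

lemma good_splits_empty_right:
  assumes "m \<le> n"
  shows "{p \<in> good_splits n m. snd p = []} = {(rev [m..<n], [])}"
proof -
  have unique: "A = rev [m..<n]" if "(A, []) \<in> good_splits n m" for A
  proof (rule decreasing_eq_rev_upt)
    show "sorted_wrt (>) A" using that by (simp add: good_splits_def good_split_def)
    show "set A = {m..<n}" using that letters_of_split[of A n "[]" m] by (simp add: good_splits_def)
  qed
  have "(rev [m..<n], []) \<in> good_splits n m"
    using assms by (auto simp: good_splits_def good_split_def sorted_wrt_rev)
  then show ?thesis
    by (intro equalityI subsetI) (clarsimp dest!: unique, simp)
qed

text \<open>
  If the least letter \<open>m\<close> is in \<open>A\<close>, then a letter of \<open>B\<close> below \<open>q = Max A\<close> would lie between
  \<open>m\<close> and \<open>q\<close>.  Hence \<open>A\<close> consists of all letters up to \<open>q\<close>, and all letters of \<open>B\<close> exceed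
  \<open>m\<close> and so decrease.
\<close>

lemma good_splits_min_left:
  assumes "m < n"
  shows "{p \<in> good_splits n m. m \<in> set (fst p)} =
    (\<lambda>q. (rev [m..<Suc q], rev [Suc q..<n])) ` {m..<n}" (is "?L = ?f ` _")
proof (rule equalityI; rule subsetI)
  fix p assume "p \<in> ?L"
  moreover obtain A B where p: "p = (A, B)" by (cases p)
  ultimately have G: "(A, B) \<in> good_splits n m" and m: "m \<in> set A" by simp_all
  have dist: "distinct (A @ n # B)" and set: "set (A @ n # B) = {m..n}" and good: "good_split A B"
    using G unfolding good_splits_def by blast+
  have A: "sorted_wrt (>) A"
    using good unfolding good_split_def by (rule conjunct1)
  have AB: "sorted_wrt (\<lambda>x y. \<not> (a < x \<and> x < y)) B" if "a \<in> set A" for a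
    using good unfolding good_split_def by (elim conjE) (rule bspec[OF _ that])
  have gap: "\<not> (a < b \<and> b < a')" if "a \<in> set A" "a' \<in> set A" "b \<in> set B" for a a' b
    using good that unfolding good_split_def by blast
  define q where "q = Max (set A)"
  have q: "q \<in> set A" "a \<in> set A \<Longrightarrow> a \<le> q" for a
    unfolding q_def using Max_in[of "set A"] Max_ge[of "set A" a] m by fastforce+
  have union: "set A \<union> set B = {m..<n}" by (rule letters_of_split[OF dist set])
  have disj: "set A \<inter> set B = {}" using dist by auto
  have B_gt: "m < b" "q < b" if b: "b \<in> set B" for b
  proof -
    show "m < b" using b m disj union by (metis UnI2 atLeastLessThan_iff disjoint_iff le_neq_implies_less)
    then have "\<not> b < q" using gap[OF m q(1) b] by simp
    moreover have "b \<noteq> q" using b q(1) disj by auto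
    ultimately show "q < b" by simp
  qed
  have qr: "q \<in> {m..<n}" using q(1) union by blast
  have "set A = {m..<Suc q}"
  proof
    show "set A \<subseteq> {m..<Suc q}" using q(2) union by (auto simp: less_Suc_eq_le)
    show "{m..<Suc q} \<subseteq> set A"
    proof
      fix x assume x: "x \<in> {m..<Suc q}"
      then have "x \<in> set A \<union> set B" unfolding union using qr by auto
      then show "x \<in> set A" using B_gt(2) x by force
    qed
  qed
  then have Aeq: "A = rev [m..<Suc q]" using A decreasing_eq_rev_upt by blast
  have "set B = {m..<n} - set A" using union disj by blast
  also have "\<dots> = {Suc q..<n}" unfolding \<open>set A = _\<close> using qr by auto
  finally have setB: "set B = {Suc q..<n}" .
  have "distinct B" using dist by simp
  then have "sorted_wrt (>) B"
    using AB[OF m] B_gt(1) unfolding sorted_wrt_iff_nth_less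
    by (metis (no_types, lifting) linorder_neqE_nat nth_eq_iff_index_eq nth_mem order.strict_trans less_irrefl)
  then have "B = rev [Suc q..<n]" using setB decreasing_eq_rev_upt by blast
  then show "p \<in> ?f ` {m..<n}" using p Aeq qr by blast
next
  fix p assume "p \<in> ?f ` {m..<n}"
  then obtain q where q: "m \<le> q" "q < n" and p: "p = (rev [m..<Suc q], rev [Suc q..<n])" by auto
  have decB: "sorted_wrt (>) (rev [Suc q..<n])" by (simp add: sorted_wrt_rev del: upt_Suc)
  have "good_split (rev [m..<Suc q]) (rev [Suc q..<n])"
    unfolding good_split_def
  proof (intro conjI ballI)
    show "sorted_wrt (>) (rev [m..<Suc q])" by (simp add: sorted_wrt_rev del: upt_Suc)
    show "sorted_wrt (\<lambda>x y. \<not> (a < x \<and> x < y)) (rev [Suc q..<n])" for a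
      by (rule sorted_wrt_mono_rel[OF _ decB]) auto
    show "triplewise (\<lambda>x y z. \<not> (x < y \<and> x < z)) (rev [Suc q..<n])"
      using decB unfolding triplewise_iff_nth sorted_wrt_iff_nth_less by (meson less_asym less_trans)
  qed auto
  then show "p \<in> ?L"
    using q p by (auto simp: good_splits_def)
qed

text \<open>
  A least letter \<open>m\<close> in \<open>B\<close> can only play the smallest role in any of the forbidden
  configurations, and that role is limited by the number of letters to its right.
\<close>

lemma good_split_min_right:
  assumes "\<forall>x\<in>set A \<union> set U \<union> set V. m < x"
  shows "good_split A (U @ m # V) \<longleftrightarrow> good_split A (U @ V) \<and> length V \<le> 1"
proof -
  have nlt: "\<not> x < m" if "x \<in> set A \<union> set U \<union> set V" for x
    using assms that less_asym by blast
  have 1: "sorted_wrt (\<lambda>x y. \<not> (a < x \<and> x < y)) (U @ m # V) \<longleftrightarrow>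
      sorted_wrt (\<lambda>x y. \<not> (a < x \<and> x < y)) (U @ V)" if "a \<in> set A" for a
    using nlt that by (simp add: sorted_wrt_append)
  have 2: "(\<forall>b\<in>set (U @ m # V). \<not> (a < b \<and> b < a')) \<longleftrightarrow> (\<forall>b\<in>set (U @ V). \<not> (a < b \<and> b < a'))"
    if "a \<in> set A" for a a'
    using nlt that by simp
  have "sorted_wrt (\<lambda>y z. \<not> (m < y \<and> m < z)) V \<longleftrightarrow> length V \<le> 1"
  proof (cases V)
    case (Cons v V')
    then show ?thesis using assms by (cases V') auto
  qed simp
  moreover have "sorted_wrt (\<lambda>x y. \<not> (x < y \<and> x < m)) U"
    using nlt unfolding sorted_wrt_iff_nth_less by (meson UnI1 UnI2 less_trans nth_mem)
  ultimately have 3: "triplewise (\<lambda>x y z. \<not> (x < y \<and> x < z)) (U @ m # V) \<longleftrightarrow>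
      triplewise (\<lambda>x y z. \<not> (x < y \<and> x < z)) (U @ V) \<and> length V \<le> 1"
    using nlt by (auto simp: triplewise_append)
  show ?thesis unfolding good_split_def using 1 2 3 by (simp cong: ball_cong)
qed

definition insert_last :: "nat \<Rightarrow> nat list \<times> nat list \<Rightarrow> nat list \<times> nat list" where
  "insert_last m p = (fst p, snd p @ [m])"

text \<open>
  Used only for a nonempty second component; \<^const>\<open>last\<close> is unspecified on the empty list.
\<close>

definition insert_before_last :: "nat \<Rightarrow> nat list \<times> nat list \<Rightarrow> nat list \<times> nat list" where
  "insert_before_last m p = (fst p, butlast (snd p) @ [m, last (snd p)])"

lemma good_splits_min_right:
  assumes "m < n"
  shows "{p \<in> good_splits n m. m \<in> set (snd p)} =
    insert_last m ` good_splits n (Suc m) \<union>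
    insert_before_last m ` {p \<in> good_splits n (Suc m). snd p \<noteq> []}" (is "?L = ?R")
proof -
  have ins: "(A, U @ m # V) \<in> good_splits n m \<longleftrightarrow> (A, U @ V) \<in> good_splits n (Suc m) \<and> length V \<le> 1"
    for A U V
  proof -
    have rng: "{m..n} = insert m {Suc m..n}" using assms by auto
    have dist: "distinct (A @ n # U @ m # V) \<and> set (A @ n # U @ m # V) = {m..n} \<longleftrightarrow>
        distinct (A @ n # U @ V) \<and> set (A @ n # U @ V) = {Suc m..n}"
    proof -
      have "set (A @ n # U @ m # V) = insert m (set (A @ n # U @ V))" by auto
      moreover have "distinct (A @ n # U @ m # V) \<longleftrightarrow> distinct (A @ n # U @ V) \<and> m \<notin> set (A @ n # U @ V)"
        by auto
      moreover have "m \<notin> {Suc m..n}" by simp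
      ultimately show ?thesis unfolding rng by (metis insert_ident)
    qed
    have "\<forall>x\<in>set A \<union> set U \<union> set V. m < x" if "set (A @ n # U @ V) = {Suc m..n}"
    proof -
      have "set A \<union> set U \<union> set V \<subseteq> {Suc m..n}" unfolding that[symmetric] by auto
      then show ?thesis by (auto simp: Suc_le_eq)
    qed
    then show ?thesis
      using dist good_split_min_right[of A U V m] unfolding good_splits_def by blast
  qed
  show ?thesis
  proof (rule equalityI; rule subsetI)
    fix p assume "p \<in> ?L"
    then obtain A B where p: "p = (A, B)" "(A, B) \<in> good_splits n m" "m \<in> set B" by (cases p) auto
    then obtain U V where B: "B = U @ m # V" using split_list by metis
    then have UV: "(A, U @ V) \<in> good_splits n (Suc m)" "length V \<le> 1" using ins p(2) by blast+
    show "p \<in> ?R"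
    proof (cases V)
      case Nil
      then have "p = insert_last m (A, U @ V)" using p B by (simp add: insert_last_def)
      then show ?thesis using UV by blast
    next
      case (Cons v V')
      then have "V = [v]" using UV(2) by simp
      then have "p = insert_before_last m (A, U @ V)" "snd (A, U @ V) \<noteq> []"
        using p B by (simp_all add: insert_before_last_def)
      then show ?thesis using UV by blast
    qed
  next
    fix p assume "p \<in> ?R"
    then consider A B where "(A, B) \<in> good_splits n (Suc m)" "p = (A, B @ [m])"
      | A B where "(A, B) \<in> good_splits n (Suc m)" "B \<noteq> []" "p = (A, butlast B @ [m, last B])"
      by (auto simp: insert_last_def insert_before_last_def)
    then show "p \<in> ?L"
    proof cases
      case 1
      then show ?thesis using ins[of A B "[]"] by simp
    next
      case 2
      then show ?thesis using ins[of A "butlast B" "[last B]"] by simp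
    qed
  qed
qed

text \<open>
  The summand \<open>n - m\<close> counts the pairs with \<open>m\<close> on the left.  The \<open>1\<close> on the left-hand side stands
  for the pair with empty \<open>B\<close>, into which \<open>m\<close> cannot be inserted before the last letter; adding it
  there avoids truncated subtraction.
\<close>

lemma card_good_splits_rec:
  assumes "m < n"
  shows "card (good_splits n m) + 1 = 2 * card (good_splits n (Suc m)) + (n - m)"
proof -
  let ?G = "good_splits n m" and ?H = "good_splits n (Suc m)"
  let ?L = "{p \<in> ?G. m \<in> set (fst p)}"
  let ?R1 = "insert_last m ` ?H" and ?R2 = "insert_before_last m ` {p \<in> ?H. snd p \<noteq> []}"
  have G: "?G = ?L \<union> {p \<in> ?G. m \<in> set (snd p)}"
  proof -
    have "m \<in> set A \<union> set B" if "(A, B) \<in> ?G" for A B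
    proof -
      have "m \<in> set (A @ n # B)" using that assms by (auto simp: good_splits_def)
      then show ?thesis using assms by auto
    qed
    then show ?thesis by fastforce
  qed
  have disj1: "?L \<inter> {p \<in> ?G. m \<in> set (snd p)} = {}" by (auto simp: good_splits_def)
  have cardL: "card ?L = n - m"
  proof -
    have "inj_on (\<lambda>q. (rev [m..<Suc q], rev [Suc q..<n])) {m..<n}"
    proof (rule inj_onI)
      fix q r assume "q \<in> {m..<n}" "r \<in> {m..<n}"
        and "(rev [m..<Suc q], rev [Suc q..<n]) = (rev [m..<Suc r], rev [Suc r..<n])"
      then have "length [m..<Suc q] = length [m..<Suc r]" "m \<le> q" "m \<le> r"
        by (metis length_rev prod.inject, simp_all)
      then show "q = r" by (simp del: upt_Suc)
    qed
    then show ?thesis unfolding good_splits_min_left[OF assms] by (simp only: card_image card_atLeastLessThan)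
  qed
  have min: "m \<notin> set B" if "(A, B) \<in> ?H" for A B
  proof
    assume "m \<in> set B"
    then have "m \<in> set (A @ n # B)" by simp
    then show False using that by (auto simp: good_splits_def)
  qed
  have disj2: "?R1 \<inter> ?R2 = {}"
  proof (rule ccontr)
    assume "?R1 \<inter> ?R2 \<noteq> {}"
    then obtain p q where q: "q \<in> ?H" "snd q \<noteq> []" and eq: "insert_last m p = insert_before_last m q"
      by blast
    have "last (snd q) = m"
      using arg_cong[OF eq, of "\<lambda>p. last (snd p)"] by (simp add: insert_last_def insert_before_last_def)
    then show False using q min[of "fst q" "snd q"] last_in_set[of "snd q"] by simp
  qed
  have inj1: "inj_on (insert_last m) ?H"
    by (auto simp: inj_on_def insert_last_def)
  have inj2: "inj_on (insert_before_last m) {p \<in> ?H. snd p \<noteq> []}"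
  proof (rule inj_onI)
    fix p q assume "p \<in> {p \<in> ?H. snd p \<noteq> []}" "q \<in> {p \<in> ?H. snd p \<noteq> []}"
      "insert_before_last m p = insert_before_last m q"
    then show "p = q"
      by (auto simp: insert_before_last_def prod_eq_iff)
        (metis append_butlast_last_id)
  qed
  have "card (?R1 \<union> ?R2) = card ?R1 + card ?R2"
    by (rule card_Un_disjoint[OF _ _ disj2]) (simp_all add: finite_good_splits)
  then have R: "card (?R1 \<union> ?R2) = card ?H + card {p \<in> ?H. snd p \<noteq> []}"
    unfolding card_image[OF inj1] card_image[OF inj2] .
  have "card ?H = card ({p \<in> ?H. snd p = []} \<union> {p \<in> ?H. snd p \<noteq> []})"
    by (rule arg_cong[where f = card]) blast
  also have "\<dots> = card {p \<in> ?H. snd p = []} + card {p \<in> ?H. snd p \<noteq> []}"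
    by (rule card_Un_disjoint) (auto simp: finite_good_splits)
  also have "card {p \<in> ?H. snd p = []} = 1"
    using good_splits_empty_right[of "Suc m" n] assms by simp
  finally have H: "card ?H = 1 + card {p \<in> ?H. snd p \<noteq> []}" .
  have "card ?G = card ?L + card {p \<in> ?G. m \<in> set (snd p)}"
    by (subst G, rule card_Un_disjoint[OF _ _ disj1]) (auto simp: finite_good_splits)
  then show ?thesis
    using cardL R H unfolding good_splits_min_right[OF assms] by simp
qed

lemma card_good_splits:
  assumes "m \<le> n"
  shows "card (good_splits n m) + (n - m + 1) = 2 ^ (n - m + 1)"
  using assms
proof (induction m rule: inc_induct)
  case base
  then show ?case by (simp add: good_splits_base)
next
  case (step m)
  have "n - m = Suc (n - Suc m)" using step.hyps by simp
  then show ?case using step.IH card_good_splits_rec[OF step.hyps(2)] by simp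
qed

lemma avoid_count_eq_card_good_splits:
  assumes "n \<ge> 1"
  shows "avoid_count n [1, 2, 3] alpha = card (good_splits n 1)"
proof -
  let ?S = "{\<sigma>. \<sigma> permutes {1..n} \<and> \<not> contains_pattern n \<sigma> [1, 2, 3] \<and> \<not> contains_arrow n \<sigma> alpha}"
  have "one_line n ` ?S = (\<lambda>(A, B). A @ n # B) ` good_splits n 1"
  proof (rule equalityI; rule subsetI)
    fix w assume "w \<in> one_line n ` ?S"
    then obtain \<sigma> where w: "w = one_line n \<sigma>" and "\<sigma> \<in> ?S" by (rule imageE)
    then have \<sigma>: "\<sigma> permutes {1..n}" "w = one_line n \<sigma>"
      "\<not> contains_pattern n \<sigma> [1, 2, 3] \<and> \<not> contains_arrow n \<sigma> alpha" by simp_all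
    have "n \<in> set w" using one_line_word(2)[OF \<sigma>(1)] \<sigma>(2) assms by simp
    then obtain A B where AB: "w = A @ n # B" using split_list by metis
    then have "good_split A B" using avoids_iff_good_split[OF \<sigma>(1), of A B] \<sigma>(2,3) by simp
    then have "(A, B) \<in> good_splits n 1"
      using one_line_word[OF \<sigma>(1)] \<open>good_split A B\<close>
      unfolding good_splits_def \<sigma>(2)[symmetric] AB by simp
    then show "w \<in> (\<lambda>(A, B). A @ n # B) ` good_splits n 1"
      by (rule rev_image_eqI) (simp only: AB prod.case)
  next
    fix w assume "w \<in> (\<lambda>(A, B). A @ n # B) ` good_splits n 1"
    then obtain p where p: "w = (\<lambda>(A, B). A @ n # B) p" "p \<in> good_splits n 1" by (rule imageE)
    moreover obtain A B where "p = (A, B)" by (cases p)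
    ultimately have w: "w = A @ n # B" "distinct w" "set w = {1..n}" "good_split A B"
      by (simp_all add: good_splits_def)
    have \<sigma>: "perm_of_word n w permutes {1..n}" "one_line n (perm_of_word n w) = w"
      using perm_of_word_permutes one_line_perm_of_word w(2,3) by blast+
    then have "perm_of_word n w \<in> ?S"
      using avoids_iff_good_split[OF \<sigma>(1), of A B] w(1,4) by simp
    then show "w \<in> one_line n ` ?S" by (rule rev_image_eqI) (simp only: \<sigma>(2))
  qed
  then have "card (one_line n ` ?S) = card (good_splits n 1)"
    by (simp only: card_image[OF inj_join])
  moreover have "inj_on (one_line n) ?S"
  proof (rule inj_onI)
    fix \<sigma> \<tau> assume "\<sigma> \<in> ?S" "\<tau> \<in> ?S" and eq: "one_line n \<sigma> = one_line n \<tau>"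
    then show "\<sigma> = \<tau>" by (intro one_line_inj[OF _ _ eq]) simp_all
  qed
  ultimately show ?thesis
    unfolding avoid_count_def by (simp only: card_image)
qed

theorem theorem3p1:
  fixes n :: nat
  assumes "n \<ge> 2"
  shows "int (avoid_count n [1, 2, 3] alpha) = 2 ^ n - int n"
proof -
  have "n \<ge> 1" "n - 1 + 1 = n" using assms by simp_all
  then have "avoid_count n [1, 2, 3] alpha + n = 2 ^ n"
    using avoid_count_eq_card_good_splits[of n] card_good_splits[of 1 n] by metis
  then have "int (avoid_count n [1, 2, 3] alpha) + int n = 2 ^ n"
    by (metis of_nat_add of_nat_numeral of_nat_power)
  then show ?thesis by simp
qed

end
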